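(* Let $a,b,c$ be real numbers, not all zero, and let $\{\mathcal{J}g_{n}^{(3)}\}_{n\geq 0}$ be the generalized Gaussian third-order Jacobsthal sequence with parameters $a,b,c$. Put $\lambda=a+b+c$, $\lambda_{1}=4a+4b-3c+(2a-5b+2c)i$, $\lambda_{2}=6a-b-c-(4a+4b-3c)i$ and $\Psi_{k}=(2\lambda_{1}+\lambda_{2})\Omega_{k}+(3\lambda_{2}-\lambda_{1})\Omega_{k+1}$ for integers $k\ge 0$. Then for all positive integers $n$ and $m$ with $n\geq m$, $$ \mathcal{J}g_{m+1}^{(3)}\mathcal{J}g_{n}^{(3)}-\mathcal{J}g_{m}^{(3)}\mathcal{J}g_{n+1}^{(3)}=\frac{1}{49}\Big\{(\lambda_{1}^{2}-\lambda_{1}\lambda_{2}+\lambda_{2}^{2})\,\Omega_{n-m}+\lambda\left(1+\tfrac{i}{2}\right)\left[2^{m}\Psi_{n}-2^{n}\Psi_{m}\right]\Big\}. $$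
   Context: Here $i$ is the imaginary unit. The generalized Gaussian third-order Jacobsthal sequence with real parameters $a,b,c$ (not all zero) is the sequence of complex numbers defined by $\mathcal{J}g_{n+3}^{(3)}=\mathcal{J}g_{n+2}^{(3)}+\mathcal{J}g_{n+1}^{(3)}+2\mathcal{J}g_{n}^{(3)}$ for $n\ge 0$, with $\mathcal{J}g_{0}^{(3)}=a+\frac{1}{2}(c-b-a)i$, $\mathcal{J}g_{1}^{(3)}=b+ai$, $\mathcal{J}g_{2}^{(3)}=c+bi$. For an integer $n$, $\Omega_{n}=\frac{\omega_1^n-\omega_2^n}{\omega_1-\omega_2}$, where $\omega_1,\omega_2$ are the roots of $x^2+x+1=0$; equivalently $\Omega_n=0,1,-1$ according as $n\equiv 0,1,2 \pmod 3$. *)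

theory Defs
  imports Complex_Main
begin

fun gauss_jacobsthal3 :: "real \<Rightarrow> real \<Rightarrow> real \<Rightarrow> nat \<Rightarrow> complex" where
  "gauss_jacobsthal3 a b c 0 = of_real a + of_real ((c - b - a) / 2) * \<i>"
| "gauss_jacobsthal3 a b c (Suc 0) = of_real b + of_real a * \<i>"
| "gauss_jacobsthal3 a b c (Suc (Suc 0)) = of_real c + of_real b * \<i>"
| "gauss_jacobsthal3 a b c (Suc (Suc (Suc n))) =
     gauss_jacobsthal3 a b c (Suc (Suc n)) + gauss_jacobsthal3 a b c (Suc n)
       + 2 * gauss_jacobsthal3 a b c n"

definition omega1 :: complex where
  "omega1 = (- 1 + \<i> * of_real (sqrt 3)) / 2"

definition omega2 :: complex where
  "omega2 = (- 1 - \<i> * of_real (sqrt 3)) / 2"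

definition Omega :: "int \<Rightarrow> complex" where
  "Omega n = (omega1 powi n - omega2 powi n) / (omega1 - omega2)"

definition lam :: "real \<Rightarrow> real \<Rightarrow> real \<Rightarrow> complex" where
  "lam a b c = of_real (a + b + c)"

definition lam1 :: "real \<Rightarrow> real \<Rightarrow> real \<Rightarrow> complex" where
  "lam1 a b c = of_real (4 * a + 4 * b - 3 * c) + of_real (2 * a - 5 * b + 2 * c) * \<i>"

definition lam2 :: "real \<Rightarrow> real \<Rightarrow> real \<Rightarrow> complex" where
  "lam2 a b c = of_real (6 * a - b - c) - of_real (4 * a + 4 * b - 3 * c) * \<i>"

definition Psi :: "real \<Rightarrow> real \<Rightarrow> real \<Rightarrow> nat \<Rightarrow> complex" where
  "Psi a b c k =
     (2 * lam1 a b c + lam2 a b c) * Omega (int k)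
       + (3 * lam2 a b c - lam1 a b c) * Omega (int k + 1)"

lemma omega_roots: "{x::complex. x\<^sup>2 + x + 1 = 0} = {omega1, omega2}"
proof -
  have s: "(complex_of_real (sqrt 3))\<^sup>2 = 3"
    by (metis of_real_numeral of_real_power real_sqrt_pow2 zero_le_numeral)
  have sum: "omega1 + omega2 = - 1"
    by (simp add: omega1_def omega2_def field_simps)
  have prod: "omega1 * omega2 = 1"
    using s by (simp add: omega1_def omega2_def field_simps power2_eq_square)
  have "x\<^sup>2 + x + 1 = (x - omega1) * (x - omega2)" for x
  proof -
    have "(x - omega1) * (x - omega2) = x\<^sup>2 - (omega1 + omega2) * x + omega1 * omega2"
      by (simp add: algebra_simps power2_eq_square)
    then show ?thesis by (simp add: sum prod)
  qed
  then show ?thesis by auto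
qed

lemma omega_distinct: "omega1 \<noteq> omega2"
  by (simp add: omega1_def omega2_def complex_eq_iff)

lemma Omega_mod3:
  "Omega n = (if n mod 3 = 0 then 0 else if n mod 3 = 1 then 1 else - 1)"
proof -
  have r: "x\<^sup>2 = - x - 1" "x powi n = x ^ nat (n mod 3)" if "x\<^sup>2 + x + 1 = 0" for x :: complex
  proof -
    show x2: "x\<^sup>2 = - x - 1"
      using that by (simp add: algebra_simps eq_neg_iff_add_eq_0)
    have "x ^ 3 = x * x\<^sup>2" by (simp add: power3_eq_cube power2_eq_square)
    also have "\<dots> = x * (- x - 1)" by (simp only: x2)
    also have "\<dots> = - x\<^sup>2 - x" by (simp add: algebra_simps power2_eq_square)
    finally have x3: "x ^ 3 = 1" by (simp add: x2)
    then have nz: "x \<noteq> 0" by auto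
    have "x powi n = x powi (3 * (n div 3) + n mod 3)" by simp
    also have "\<dots> = (x powi 3) powi (n div 3) * x powi (n mod 3)"
      using power_int_add[of x "3 * (n div 3)" "n mod 3"] nz by (simp only: power_int_mult simp_thms)
    also have "\<dots> = x powi (n mod 3)" using x3 by simp
    also have "\<dots> = x ^ nat (n mod 3)" by (simp add: power_int_def)
    finally show "x powi n = x ^ nat (n mod 3)" .
  qed
  have e: "omega1\<^sup>2 + omega1 + 1 = 0" "omega2\<^sup>2 + omega2 + 1 = 0"
    using omega_roots by auto
  have d: "omega1 - omega2 \<noteq> 0" using omega_distinct by simp
  have "n mod 3 = 0 \<or> n mod 3 = 1 \<or> n mod 3 = 2" by presburger
  moreover have "nat 2 = 2" by simp
  moreover have "- omega1 - 1 - (- omega2 - 1) = - (omega1 - omega2)" by simp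
  ultimately show ?thesis
    using d unfolding Omega_def r(2)[OF e(1)] r(2)[OF e(2)]
    by (elim disjE) (simp_all add: r(1)[OF e(1)] r(1)[OF e(2)] field_simps)
qed

end

theory Submission
  imports Defs
begin

text \<open>The characteristic roots of the recurrence are \<open>2\<close>, \<open>omega1\<close> and \<open>omega2\<close>, so the \<open>n\<close>-th term
  is \<open>(\<mu> 2\<^sup>n + V\<^sub>n) / 7\<close> with \<open>\<mu> = \<lambda> (1 + i/2)\<close> and a 3-periodic part
  \<open>V\<^sub>n = \<lambda>\<^sub>1 \<Omega>\<^sub>n + \<lambda>\<^sub>2 \<Omega>\<^sub>n\<^sub>+\<^sub>1\<close>. Substituting, the terms in \<open>\<mu>\<^sup>2\<close> cancel, the mixed terms give
  \<open>\<Psi>\<^sub>k = 2 V\<^sub>k - V\<^sub>k\<^sub>+\<^sub>1\<close>, and the purely periodic terms form a Casoratian of \<open>V\<close>, which is a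
  multiple of \<open>\<Omega>\<^sub>n\<^sub>-\<^sub>m\<close>.\<close>

lemma Omega_0 [simp]: "Omega 0 = 0" and Omega_1 [simp]: "Omega 1 = 1"
  by (simp_all add: Omega_mod3)

lemma Omega_add_2: "Omega (k + 2) = - Omega (k + 1) - Omega k"
proof -
  have "k mod 3 = 0 \<and> (k + 1) mod 3 = 1 \<and> (k + 2) mod 3 = 2
      \<or> k mod 3 = 1 \<and> (k + 1) mod 3 = 2 \<and> (k + 2) mod 3 = 0
      \<or> k mod 3 = 2 \<and> (k + 1) mod 3 = 0 \<and> (k + 2) mod 3 = 1"
    by presburger
  then show ?thesis
    by (auto simp: Omega_mod3)
qed

text \<open>Both sides depend only on \<open>j\<close> and \<open>k\<close> mod 3, which leaves nine
  cases.\<close>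

lemma Omega_casoratian: "Omega (j + 1) * Omega (k) - Omega (j) * Omega (k + 1) = Omega (k - j)"
proof -
  define r s where "r = j mod 3" and "s = k mod 3"
  have "r \<in> {0, 1, 2}" "s \<in> {0, 1, 2}"
    by (auto simp: r_def s_def)
  moreover have "(k - j) mod 3 = (s - r) mod 3"
    "(j + 1) mod 3 = (r + 1) mod 3" "(k + 1) mod 3 = (s + 1) mod 3"
    by (simp_all add: r_def s_def mod_simps)
  ultimately show ?thesis
    unfolding Omega_mod3 r_def[symmetric] s_def[symmetric]
    by (elim insertE emptyE) simp_all
qed

definition omega_comb :: "complex \<Rightarrow> complex \<Rightarrow> nat \<Rightarrow> complex" where
  "omega_comb p q n = p * Omega (int n) + q * Omega (int n + 1)"

lemma omega_comb_0: "omega_comb p q 0 = q"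
  by (simp add: omega_comb_def)

lemma omega_comb_Suc_0: "omega_comb p q (Suc 0) = p - q"
  using Omega_add_2[of 0] by (simp add: omega_comb_def)

lemma omega_comb_Suc:
  "omega_comb p q (Suc n) = (p - q) * Omega (int n + 1) - q * Omega (int n)"
proof -
  have "int (Suc n) = int n + 1" "int n + 1 + 1 = int n + 2"
    by simp_all
  then show ?thesis
    by (simp only: omega_comb_def Omega_add_2) (simp add: algebra_simps)
qed

lemma omega_comb_add_2: "omega_comb p q (Suc (Suc n)) = - omega_comb p q (Suc n) - omega_comb p q n"
proof -
  have "int (Suc n) = int n + 1" "int n + 1 + 1 = int n + 2"
    by simp_all
  then show ?thesis
    by (simp only: omega_comb_Suc omega_comb_def[of _ _ n] Omega_add_2) (simp add: algebra_simps)
qed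

text \<open>Consecutive values of \<open>omega_comb\<close> arise from those of \<open>Omega\<close>
  by a linear map of determinant \<open>p * (p - q) + q * q\<close>, which scales the
  Casoratian.\<close>

lemma omega_comb_casoratian:
  "omega_comb p q (Suc m) * omega_comb p q n - omega_comb p q m * omega_comb p q (Suc n)
     = (p\<^sup>2 - p * q + q\<^sup>2) * Omega (int n - int m)"
  unfolding Omega_casoratian[symmetric] omega_comb_Suc omega_comb_def[of _ _ m]
    omega_comb_def[of _ _ n]
  by (simp add: algebra_simps power2_eq_square)

lemma Psi_eq_omega_comb:
  "Psi a b c k = 2 * omega_comb (lam1 a b c) (lam2 a b c) k
                   - omega_comb (lam1 a b c) (lam2 a b c) (Suc k)"
  unfolding omega_comb_Suc by (simp add: Psi_def omega_comb_def algebra_simps)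

lemma gauss_jacobsthal3_binet:
  "gauss_jacobsthal3 a b c n
     = (lam a b c * (1 + \<i> / 2) * 2 ^ n + omega_comb (lam1 a b c) (lam2 a b c) n) / 7"
proof (induction a b c n rule: gauss_jacobsthal3.induct)
  case (4 a b c n)
  define \<mu> where "\<mu> = lam a b c * (1 + \<i> / 2)"
  \<comment> \<open>Powers of 2 fit since 8 = 4 + 2 + 2, the periodic part since any three
    consecutive terms sum to zero.\<close>
  show ?case
    unfolding gauss_jacobsthal3.simps 4 \<mu>_def[symmetric]
    by (simp add: omega_comb_add_2 algebra_simps flip: add_divide_distrib)
qed (simp_all add: omega_comb_0 omega_comb_Suc_0 omega_comb_add_2 lam_def lam1_def lam2_def
       complex_eq_iff field_simps)

theorem theorem2p7:
  fixes a b c :: real and n m :: nat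
  assumes "\<not> (a = 0 \<and> b = 0 \<and> c = 0)"
    and "0 < m" and "0 < n" and "m \<le> n"
  shows "gauss_jacobsthal3 a b c (m + 1) * gauss_jacobsthal3 a b c n
           - gauss_jacobsthal3 a b c m * gauss_jacobsthal3 a b c (n + 1)
         = 1 / 49 * (((lam1 a b c)\<^sup>2 - lam1 a b c * lam2 a b c + (lam2 a b c)\<^sup>2)
                       * Omega (int n - int m)
             + lam a b c * (1 + \<i> / 2) * (2 ^ m * Psi a b c n - 2 ^ n * Psi a b c m))"
proof -
  \<comment> \<open>Keeping \<mu> atomic leaves a polynomial identity.\<close>
  define \<mu> where "\<mu> = lam a b c * (1 + \<i> / 2)"
  show ?thesis
    unfolding gauss_jacobsthal3_binet Psi_eq_omega_comb omega_comb_casoratian[symmetric]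
      \<mu>_def[symmetric]
    by (simp add: field_simps)
qed

end
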